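(* Let $(\mathcal G,\mathcal Y_{\mathcal V},\theta)$ be a graphical model and let $(\mathcal G^\tau)_{\tau\in\mathcal T}$ be any acyclic decomposition of $\mathcal G$ (all slave subgraphs $\mathcal G^\tau$ are acyclic). Then the optimal value of the decomposition-based dual coincides with the optimal value of the Lagrange dual: $$\max_{\theta^{\mathcal T}\in\Theta^{\mathcal T}}\mathcal U(\theta^{\mathcal T})=\max_{\phi\in\mathbb R^{\mathcal J}}\mathcal D(\phi).$$
   Context: Graphical model: $\mathcal G=(\mathcal V,\mathcal E)$ is a finite simple undirected graph, each node $u$ has a finite non-empty label set $\mathcal Y_u$; $\mathcal Y_{uv}=\mathcal Y_u\times\mathcal Y_v$ for $uv\in\mathcal E$, $\mathcal Y_{\mathcal A}=\prod_{u\in\mathcal A}\mathcal Y_u$ for $\mathcal A\subseteq\mathcal V$; the real cost vector $\theta$ has components $\theta_w(s)$ for $w\in\mathcal V\cup\mathcal E$, $s\in\mathcal Y_w$. For a labeling $y$ put $y_{uv}=(y_u,y_v)$. $\mathcal N_b(u)$ is the set of neighbors of $u$. Lagrange dual: $\mathcal J=\{(u,v,s):u\in\mathcal V,\ v\in\mathcal N_b(u),\ s\in\mathcal Y_u\}$; for $\phi\in\mathbb R^{\mathcal J}$ the reparametrized costs are $\theta^\phi_u(s)=\theta_u(s)-\sum_{v\in\mathcal N_b(u)}\phi_{u,v}(s)$ and $\theta^\phi_{uv}(s,t)=\theta_{uv}(s,t)+\phi_{u,v}(s)+\phi_{v,u}(t)$; and $\mathcal D(\phi)=\sum_{w\in\mathcal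 V\cup\mathcal E}\min_{s\in\mathcal Y_w}\theta^\phi_w(s)$. Decomposition: a finite collection of subgraphs $\mathcal G^\tau=(\mathcal V^\tau,\mathcal E^\tau)$, $\tau\in\mathcal T$, of $\mathcal G$ such that each node and each edge of $\mathcal G$ belongs to at least one of them. $\mathcal T_w=\{\tau\in\mathcal T:w\in\mathcal V^\tau\cup\mathcal E^\tau\}$. $\Theta^{\mathcal T}$ is the set of collections $\theta^{\mathcal T}=(\theta^\tau)_{\tau\in\mathcal T}$ of cost vectors $\theta^\tau=(\theta^\tau_w(s))_{w\in\mathcal V^\tau\cup\mathcal E^\tau,\,s\in\mathcal Y_w}$ with $\sum_{\tau\in\mathcal T_w}\theta^\tau_w=\theta_w$ for all $w\in\mathcal V\cup\mathcal E$. The decomposition-based dual is $\mathcal U(\theta^{\mathcal T})=\sum_{\tau\in\mathcal T}\min_{y\in\mathcal Y_{\mathcal V^\tau}}\sum_{w\in\mathcal V^\tau\cup\mathcal E^\tau}\theta^\tau_w(y_w)$. (The paper equivalently writes $\max_{\lambda}\mathcal U(\theta^{\mathcal T}[\lambda])$ using an unconstrained parametrization $\lambda\mapsto\theta^{\mathcal T}[\lambda]$ of $\Theta^{\mathcal T}$.) *)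

theory Defs
  imports Complex_Main "HOL-Library.FuncSet"
begin

text \<open>
  A simple undirected graph. Every undirected edge \<open>uv\<close> is stored exactly once, as one of the
  pairs \<open>(u, v)\<close>, \<open>(v, u)\<close>, chosen arbitrarily. The stored order fixes the reading of the label
  set of the edge as the product \<open>Y u \<times> Y v\<close>; it has no other meaning, and all graph notions
  below refer to the symmetric relation \<open>adjacent\<close>.
\<close>

record 'v graph =
  nodes :: "'v set"
  edges :: "('v \<times> 'v) set"

definition finite_simple_graph :: "'v graph \<Rightarrow> bool" where
  "finite_simple_graph G \<longleftrightarrow>
     finite (nodes G) \<and> edges G \<subseteq> nodes G \<times> nodes G \<and>
     (\<forall>(u, v) \<in> edges G. u \<noteq> v \<and> (v, u) \<notin> edges G)"

definition adjacent :: "'v graph \<Rightarrow> 'v \<Rightarrow> 'v \<Rightarrow> bool" where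
  "adjacent G u v \<longleftrightarrow> (u, v) \<in> edges G \<or> (v, u) \<in> edges G"

definition neighbors :: "'v graph \<Rightarrow> 'v \<Rightarrow> 'v set" where
  "neighbors G u = {v. adjacent G u v}"

definition subgraph :: "'v graph \<Rightarrow> 'v graph \<Rightarrow> bool" where
  "subgraph H G \<longleftrightarrow>
     nodes H \<subseteq> nodes G \<and> edges H \<subseteq> edges G \<and> edges H \<subseteq> nodes H \<times> nodes H"

text \<open>A cycle is given by its list of pairwise distinct nodes, without repeating the first one.\<close>

definition is_cycle :: "'v graph \<Rightarrow> 'v list \<Rightarrow> bool" where
  "is_cycle G xs \<longleftrightarrow>
     3 \<le> length xs \<and> distinct xs \<and> successively (adjacent G) xs \<and> adjacent G (last xs) (hd xs)"

definition acyclic_graph :: "'v graph \<Rightarrow> bool" where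
  "acyclic_graph G \<longleftrightarrow> (\<nexists>xs. is_cycle G xs)"

text \<open>
  Cost vectors and dual variables are represented by total functions. Only the components that
  occur in the mathematical objects (nodes and edges of the graph at hand, labels in \<open>Y\<close>, and for
  dual variables pairs of adjacent nodes) are ever used; all other values are irrelevant.
\<close>

record ('v, 'l) costs =
  node_cost :: "'v \<Rightarrow> 'l \<Rightarrow> real"
  edge_cost :: "'v \<times> 'v \<Rightarrow> 'l \<times> 'l \<Rightarrow> real"

definition graphical_model :: "'v graph \<Rightarrow> ('v \<Rightarrow> 'l set) \<Rightarrow> bool" where
  "graphical_model G Y \<longleftrightarrow>
     finite_simple_graph G \<and> (\<forall>u \<in> nodes G. finite (Y u) \<and> Y u \<noteq> {})"

definition reparametrize ::
    "'v graph \<Rightarrow> ('v, 'l) costs \<Rightarrow> ('v \<Rightarrow> 'v \<Rightarrow> 'l \<Rightarrow> real) \<Rightarrow> ('v, 'l) costs" where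
  "reparametrize G \<theta> \<phi> =
     \<lparr>node_cost = (\<lambda>u s. node_cost \<theta> u s - (\<Sum>v \<in> neighbors G u. \<phi> u v s)),
      edge_cost = (\<lambda>(u, v) (s, t). edge_cost \<theta> (u, v) (s, t) + \<phi> u v s + \<phi> v u t)\<rparr>"

definition lagrange_dual ::
    "'v graph \<Rightarrow> ('v \<Rightarrow> 'l set) \<Rightarrow> ('v, 'l) costs \<Rightarrow> ('v \<Rightarrow> 'v \<Rightarrow> 'l \<Rightarrow> real) \<Rightarrow> real" where
  "lagrange_dual G Y \<theta> \<phi> =
     (\<Sum>u \<in> nodes G. MIN s \<in> Y u. node_cost (reparametrize G \<theta> \<phi>) u s) +
     (\<Sum>(u, v) \<in> edges G. MIN p \<in> Y u \<times> Y v. edge_cost (reparametrize G \<theta> \<phi>) (u, v) p)"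

definition decomposition :: "'v graph \<Rightarrow> 't set \<Rightarrow> ('t \<Rightarrow> 'v graph) \<Rightarrow> bool" where
  "decomposition G T H \<longleftrightarrow>
     finite T \<and> (\<forall>\<tau> \<in> T. subgraph (H \<tau>) G) \<and>
     (\<forall>u \<in> nodes G. \<exists>\<tau> \<in> T. u \<in> nodes (H \<tau>)) \<and>
     (\<forall>e \<in> edges G. \<exists>\<tau> \<in> T. e \<in> edges (H \<tau>))"

definition slave_costs ::
    "'v graph \<Rightarrow> ('v \<Rightarrow> 'l set) \<Rightarrow> ('v, 'l) costs \<Rightarrow> 't set \<Rightarrow> ('t \<Rightarrow> 'v graph)
       \<Rightarrow> ('t \<Rightarrow> ('v, 'l) costs) set" where
  "slave_costs G Y \<theta> T H =
     {\<theta>T. (\<forall>u \<in> nodes G. \<forall>s \<in> Y u.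
              (\<Sum>\<tau> \<in> {\<tau> \<in> T. u \<in> nodes (H \<tau>)}. node_cost (\<theta>T \<tau>) u s) = node_cost \<theta> u s) \<and>
           (\<forall>(u, v) \<in> edges G. \<forall>p \<in> Y u \<times> Y v.
              (\<Sum>\<tau> \<in> {\<tau> \<in> T. (u, v) \<in> edges (H \<tau>)}. edge_cost (\<theta>T \<tau>) (u, v) p)
                = edge_cost \<theta> (u, v) p)}"

definition energy :: "'v graph \<Rightarrow> ('v, 'l) costs \<Rightarrow> ('v \<Rightarrow> 'l) \<Rightarrow> real" where
  "energy G \<theta> y =
     (\<Sum>u \<in> nodes G. node_cost \<theta> u (y u)) +
     (\<Sum>(u, v) \<in> edges G. edge_cost \<theta> (u, v) (y u, y v))"

definition decomposition_dual ::
    "('v \<Rightarrow> 'l set) \<Rightarrow> 't set \<Rightarrow> ('t \<Rightarrow> 'v graph) \<Rightarrow> ('t \<Rightarrow> ('v, 'l) costs) \<Rightarrow> real" where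
  "decomposition_dual Y T H \<theta>T =
     (\<Sum>\<tau> \<in> T. MIN y \<in> PiE (nodes (H \<tau>)) Y. energy (H \<tau>) (\<theta>T \<tau>) y)"

end

theory Submission
  imports Defs
begin

text \<open>
  On a forest the Lagrange dual is tight: eliminating leaves one at a time and passing min-marginals
  as messages yields dual variables \<open>\<phi>\<close> whose dual value is the energy of some labeling. Summing
  such dual variables over the slaves turns any decomposition into a \<open>\<phi>\<close> on the whole graph with
  at least the same dual value, because the minimum of a sum is at least the sum of the minima.
  Conversely, distributing reparametrized costs equally over the slaves shows that the
  decomposition-based dual reaches every value of \<open>lagrange_dual\<close>. The maximum is attained because
  \<open>lagrange_dual\<close> is bounded by the energy of any labeling and is a minimum of finitely many affine
  functions of finitely many coordinates.
\<close>

section \<open>Reparametrization and leaves\<close>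

lemma finite_edges: "finite_simple_graph G \<Longrightarrow> finite (edges G)"
  unfolding finite_simple_graph_def by (meson finite_SigmaI finite_subset)

lemma neighbors_subset_nodes: "finite_simple_graph G \<Longrightarrow> neighbors G u \<subseteq> nodes G"
  unfolding finite_simple_graph_def neighbors_def adjacent_def by auto

lemma finite_neighbors: "finite_simple_graph G \<Longrightarrow> finite (neighbors G u)"
  by (meson neighbors_subset_nodes finite_simple_graph_def finite_subset)

lemma adjacent_commute: "adjacent G u v \<longleftrightarrow> adjacent G v u"
  unfolding adjacent_def by auto

lemma adjacent_nodes:
  assumes "finite_simple_graph G" "adjacent G u v"
  shows "u \<in> nodes G" "v \<in> nodes G" "u \<noteq> v"
  using assms unfolding finite_simple_graph_def adjacent_def by auto

text \<open>Every edge is stored once but seen from both of its ends: the pairs of a node and its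
  neighbor are the disjoint union of \<open>edges G\<close> and its image under
  \<open>prod.swap\<close>.\<close>

lemma sum_neighbors:
  fixes f :: "'v \<Rightarrow> 'v \<Rightarrow> 'a::comm_monoid_add"
  assumes G: "finite_simple_graph G"
  shows "(\<Sum>u\<in>nodes G. \<Sum>v\<in>neighbors G u. f u v) = (\<Sum>(u, v)\<in>edges G. f u v + f v u)"
proof -
  have fin: "finite (nodes G)" using G by (simp add: finite_simple_graph_def)
  have S: "Sigma (nodes G) (neighbors G) = edges G \<union> prod.swap ` edges G"
    using G unfolding finite_simple_graph_def neighbors_def adjacent_def by force
  have disj: "edges G \<inter> prod.swap ` edges G = {}"
    using G unfolding finite_simple_graph_def by fastforce
  have "(\<Sum>u\<in>nodes G. \<Sum>v\<in>neighbors G u. f u v)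
      = (\<Sum>(u, v)\<in>edges G \<union> prod.swap ` edges G. f u v)"
    using fin finite_neighbors[OF G] by (simp add: sum.Sigma S)
  also have "\<dots> = (\<Sum>(u, v)\<in>edges G. f u v) + (\<Sum>(u, v)\<in>prod.swap ` edges G. f u v)"
    using disj finite_edges[OF G] by (intro sum.union_disjoint) auto
  also have "(\<Sum>(u, v)\<in>prod.swap ` edges G. f u v) = (\<Sum>(u, v)\<in>edges G. f v u)"
    by (subst sum.reindex) (auto simp: case_prod_unfold)
  finally show ?thesis by (simp add: sum.distrib case_prod_unfold)
qed

text \<open>Each \<open>\<phi> u v (y u)\<close> is subtracted at the node \<open>u\<close> and
  added on the edge between \<open>u\<close> and \<open>v\<close>, so all of them cancel for every
  labeling.\<close>

lemma energy_reparametrize: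
  assumes "finite_simple_graph G"
  shows "energy G (reparametrize G \<theta> \<phi>) y = energy G \<theta> y"
proof -
  have "energy G (reparametrize G \<theta> \<phi>) y
      = energy G \<theta> y - (\<Sum>u\<in>nodes G. \<Sum>v\<in>neighbors G u. \<phi> u v (y u))
        + (\<Sum>(u, v)\<in>edges G. \<phi> u v (y u) + \<phi> v u (y v))"
    by (simp add: energy_def reparametrize_def sum_subtractf sum.distrib case_prod_unfold)
  then show ?thesis by (simp add: sum_neighbors[OF assms])
qed

text \<open>Weak duality: each local minimum is at most the local reparametrized cost at
  \<open>y\<close>, and these costs add up to the original energy.\<close>

lemma lagrange_dual_le_energy:
  assumes G: "graphical_model G Y" and y: "\<And>u. u \<in> nodes G \<Longrightarrow> y u \<in> Y u"
  shows "lagrange_dual G Y \<theta> \<phi> \<le> energy G \<theta> y"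
proof -
  have fsg: "finite_simple_graph G" using G by (simp add: graphical_model_def)
  have fin: "finite (Y u)" if "u \<in> nodes G" for u
    using G that by (simp add: graphical_model_def)
  have E: "u \<in> nodes G" "v \<in> nodes G" if "(u, v) \<in> edges G" for u v
    using fsg that by (auto simp: finite_simple_graph_def)
  have "lagrange_dual G Y \<theta> \<phi> \<le> energy G (reparametrize G \<theta> \<phi>) y"
    unfolding lagrange_dual_def energy_def
    by (intro add_mono sum_mono) (auto intro!: Min_le finite_imageI finite_cartesian_product imageI y fin dest: E)
  then show ?thesis by (simp add: energy_reparametrize[OF fsg])
qed

lemma graphical_model_subgraph:
  "graphical_model G Y \<Longrightarrow> subgraph H G \<Longrightarrow> graphical_model H Y"
  unfolding graphical_model_def finite_simple_graph_def subgraph_def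
  by (blast intro: finite_subset)

text \<open>The first node of a longest path is a leaf: a second neighbor would either prolong the
  path or close a cycle with it.\<close>

lemma acyclic_leaf:
  assumes G: "finite_simple_graph G" and ac: "acyclic_graph G" and ne: "edges G \<noteq> {}"
  shows "\<exists>u v. neighbors G v = {u}"
proof -
  \<comment> \<open>\<open>P\<close> describes paths with at least two nodes, so that the first node
    \<open>v\<close> has a successor \<open>u\<close>; distinctness bounds their length by the
    number of nodes.\<close>
  define P where "P xs \<longleftrightarrow> 2 \<le> length xs \<and> distinct xs \<and> successively (adjacent G) xs \<and>
    set xs \<subseteq> nodes G" for xs
  obtain a b where ab: "(a, b) \<in> edges G" using ne by auto
  then have "P [a, b]" using G
    by (auto simp: P_def adjacent_def finite_simple_graph_def)
  moreover have "length xs \<le> card (nodes G)" if "P xs" for xs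
    using that G card_mono[of "nodes G" "set xs"]
    by (auto simp: P_def distinct_card finite_simple_graph_def)
  ultimately have "\<exists>xs. P xs \<and> (\<forall>ys. P ys \<longrightarrow> length ys \<le> length xs)"
    by (intro ex_has_greatest_nat[of P "[a, b]" _ "Suc (card (nodes G))"]) (auto simp: less_Suc_eq_le)
  then obtain xs where xs: "P xs" and mx: "\<And>ys. P ys \<Longrightarrow> length ys \<le> length xs"
    by auto
  from xs obtain v u zs where xs_eq: "xs = v # u # zs"
    by (cases xs; cases "tl xs") (auto simp: P_def)
  have vu: "adjacent G v u" using xs by (simp add: P_def xs_eq)
  have "w = u" if w: "adjacent G v w" for w
  proof (rule ccontr)
    assume "w \<noteq> u"
    have "w \<in> set zs"
    proof (rule ccontr)
      assume "w \<notin> set zs"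
      then have "P (w # xs)"
        using xs w \<open>w \<noteq> u\<close> adjacent_nodes[OF G w] by (auto simp: P_def xs_eq adjacent_commute)
      then show False using mx by fastforce
    qed
    then obtain as bs where "zs = as @ w # bs" by (meson split_list)
    \<comment> \<open>The part of the path from \<open>v\<close> up to \<open>w\<close> is closed by
      the edge between \<open>w\<close> and \<open>v\<close>; it has at least the three nodes
      \<open>v\<close>, \<open>u\<close>, \<open>w\<close>.\<close>
    then have "is_cycle G (v # u # as @ [w])"
      using xs w unfolding P_def is_cycle_def xs_eq
      by (auto simp: successively_append_iff successively_Cons adjacent_commute hd_append
            split: if_splits)
    then show False using ac by (auto simp: acyclic_graph_def)
  qed
  with vu have "neighbors G v = {u}" unfolding neighbors_def by blast
  then show ?thesis by blast
qed

lemma acyclic_graph_mono: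
  assumes "edges H \<subseteq> edges G" "acyclic_graph G"
  shows "acyclic_graph H"
proof -
  have "adjacent G u v" if "adjacent H u v" for u v
    using that assms by (auto simp: adjacent_def)
  then show ?thesis using assms(2) unfolding acyclic_graph_def is_cycle_def
    by (metis successively_mono)
qed

section \<open>Tightness on forests\<close>

text \<open>The cost of an edge with the label of \<open>u\<close> first, whichever order is stored.
  This spares the leaf argument a case split on the orientation.\<close>

definition oriented_edge_cost :: "'v graph \<Rightarrow> ('v, 'l) costs \<Rightarrow> 'v \<Rightarrow> 'v \<Rightarrow> 'l \<Rightarrow> 'l \<Rightarrow> real" where
  "oriented_edge_cost F \<theta> u v s t =
     (if (u, v) \<in> edges F then edge_cost \<theta> (u, v) (s, t) else edge_cost \<theta> (v, u) (t, s))"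

abbreviation delete_edge :: "'v graph \<Rightarrow> 'v \<Rightarrow> 'v \<Rightarrow> 'v graph" where
  "delete_edge F u v \<equiv> F\<lparr>edges := edges F - {(u, v), (v, u)}\<rparr>"

text \<open>Exactly one of the two orders is stored, so deleting both pairs removes a single
  summand.\<close>

lemma sum_edges_delete_edge:
  fixes g :: "'v \<times> 'v \<Rightarrow> 'a::comm_monoid_add"
  assumes F: "finite_simple_graph F" and uv: "adjacent F u v"
  shows "sum g (edges F) = sum g (edges (delete_edge F u v)) +
      (if (u, v) \<in> edges F then g (u, v) else g (v, u))"
proof (cases "(u, v) \<in> edges F")
  case True
  then have "(v, u) \<notin> edges F" using F by (auto simp: finite_simple_graph_def)
  then have "edges (delete_edge F u v) = edges F - {(u, v)}" by auto
  then show ?thesis using True sum.remove[OF finite_edges[OF F] True, of g] by (simp add: add.commute)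
next
  case False
  then have vu: "(v, u) \<in> edges F" using uv by (auto simp: adjacent_def)
  have "edges (delete_edge F u v) = edges F - {(v, u)}" using False by auto
  then show ?thesis using False sum.remove[OF finite_edges[OF F] vu, of g] by (simp add: add.commute)
qed

lemma energy_delete_edge:
  assumes "finite_simple_graph F" "adjacent F u v"
  shows "energy F \<theta> y = energy (delete_edge F u v) \<theta> y + oriented_edge_cost F \<theta> u v (y u) (y v)"
  using sum_edges_delete_edge[OF assms, of "\<lambda>(u, v). edge_cost \<theta> (u, v) (y u, y v)"]
  by (simp add: energy_def oriented_edge_cost_def)

text \<open>The deleted edge contributes a nonnegative minimum, and all other local terms of the two
  duals agree. This is the dual half of the induction step for forests.\<close>

lemma lagrange_dual_delete_edge_le:
  assumes F: "graphical_model F Y" and uv: "adjacent F u v"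
    and nonneg: "\<And>s t. s \<in> Y u \<Longrightarrow> t \<in> Y v \<Longrightarrow> 0 \<le> oriented_edge_cost F \<theta> u v s t + \<phi> u v s + \<phi> v u t"
    and node: "\<And>x s. x \<in> nodes F \<Longrightarrow> node_cost (reparametrize F \<theta> \<phi>) x s
        = node_cost (reparametrize (delete_edge F u v) \<theta>' \<phi>') x s"
    and edge: "\<And>x z p. (x, z) \<in> edges (delete_edge F u v) \<Longrightarrow> edge_cost (reparametrize F \<theta> \<phi>) (x, z) p
        = edge_cost (reparametrize (delete_edge F u v) \<theta>' \<phi>') (x, z) p"
  shows "lagrange_dual (delete_edge F u v) Y \<theta>' \<phi>' \<le> lagrange_dual F Y \<theta> \<phi>"
proof -
  let ?F = "delete_edge F u v"
  have fsg: "finite_simple_graph F" using F by (simp add: graphical_model_def)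
  have Y: "finite (Y u)" "Y u \<noteq> {}" "finite (Y v)" "Y v \<noteq> {}"
    using F adjacent_nodes[OF fsg uv] by (auto simp: graphical_model_def)
  let ?g = "\<lambda>(u, v). MIN p\<in>Y u \<times> Y v. edge_cost (reparametrize F \<theta> \<phi>) (u, v) p"
  have "0 \<le> (if (u, v) \<in> edges F then ?g (u, v) else ?g (v, u))"
    using Y nonneg by (auto simp: reparametrize_def oriented_edge_cost_def add_ac split: if_splits)
  then have "sum ?g (edges ?F) \<le> sum ?g (edges F)"
    using sum_edges_delete_edge[OF fsg uv, of ?g] by simp
  moreover have "sum ?g (edges ?F) =
      (\<Sum>(u, v)\<in>edges ?F. MIN p\<in>Y u \<times> Y v. edge_cost (reparametrize ?F \<theta>' \<phi>') (u, v) p)"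
    by (intro sum.cong refl, clarify, intro arg_cong[where f = Min] image_cong refl edge)
  moreover have "(\<Sum>x\<in>nodes F. MIN s\<in>Y x. node_cost (reparametrize F \<theta> \<phi>) x s)
      = (\<Sum>x\<in>nodes ?F. MIN s\<in>Y x. node_cost (reparametrize ?F \<theta>' \<phi>') x s)"
    using node by (intro sum.cong) auto
  ultimately show ?thesis by (simp add: lagrange_dual_def)
qed

text \<open>
  Induction on the number of edges. The min-marginal of a leaf \<open>v\<close> is passed as a message to its
  only neighbor \<open>u\<close>, which makes the edge contribute nothing to the dual and leaves \<open>v\<close> isolated
  with zero cost.
\<close>

lemma forest_tight:
  assumes "graphical_model F Y" "acyclic_graph F"
  shows "\<exists>\<phi> y. y \<in> PiE (nodes F) Y \<and> energy F \<theta> y \<le> lagrange_dual F Y \<theta> \<phi>"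
  using assms
proof (induction "card (edges F)" arbitrary: F \<theta> rule: less_induct)
  case less
  have F: "finite_simple_graph F" using less.prems by (simp add: graphical_model_def)
  have Y: "finite (Y x)" "Y x \<noteq> {}" if "x \<in> nodes F" for x
    using less.prems that by (auto simp: graphical_model_def)
  show ?case
  proof (cases "edges F = {}")
    case True
    \<comment> \<open>Without edges the energy is minimized node by node, and zero dual variables
      already give equality.\<close>
    have "\<exists>s\<in>Y x. node_cost \<theta> x s = (MIN s\<in>Y x. node_cost \<theta> x s)" if "x \<in> nodes F" for x
    proof -
      have "(MIN s\<in>Y x. node_cost \<theta> x s) \<in> node_cost \<theta> x ` Y x"
        using Y[OF that] by (intro Min_in) auto
      then show ?thesis by (metis imageE)
    qed
    then obtain m where m: "\<And>x. x \<in> nodes F \<Longrightarrow> m x \<in> Y x"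
      "\<And>x. x \<in> nodes F \<Longrightarrow> node_cost \<theta> x (m x) = (MIN s\<in>Y x. node_cost \<theta> x s)" by metis
    have "energy F \<theta> (restrict m (nodes F)) = lagrange_dual F Y \<theta> (\<lambda>_ _ _. 0)"
      using m(2) by (simp add: energy_def lagrange_dual_def reparametrize_def True)
    then show ?thesis using m(1) by (intro exI[of _ "restrict m (nodes F)"] exI) auto
  next
    case False
    obtain u v where nv: "neighbors F v = {u}" using acyclic_leaf F less.prems(2) False by blast
    then have vu: "adjacent F v u" and uv: "adjacent F u v"
      by (auto simp: neighbors_def adjacent_commute)
    note nodes = adjacent_nodes[OF F uv]
    define F' where "F' = delete_edge F u v"
    define c where "c = oriented_edge_cost F \<theta> u v"
    define m where "m s = (MIN t\<in>Y v. c s t + node_cost \<theta> v t)" for s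
    \<comment> \<open>The smaller problem sees the leaf only through the message \<open>m\<close>,
      which is added to the costs of \<open>u\<close>.\<close>
    define \<theta>' where "\<theta>' = \<theta>\<lparr>node_cost := (node_cost \<theta>)
      (v := (\<lambda>_. 0), u := (\<lambda>s. node_cost \<theta> u s + m s))\<rparr>"
    have nodes_F': "nodes F' = nodes F" by (simp add: F'_def)
    have "card (edges F') < card (edges F)"
      using uv finite_edges[OF F]
      by (intro psubset_card_mono) (auto simp: F'_def adjacent_def)
    moreover have F'_model: "graphical_model F' Y"
      using less.prems(1) by (auto simp: graphical_model_def finite_simple_graph_def F'_def)
    moreover have "acyclic_graph F'"
      by (rule acyclic_graph_mono[OF _ less.prems(2)]) (auto simp: F'_def)
    ultimately obtain \<phi>' y' where y': "y' \<in> PiE (nodes F') Y"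
      and le: "energy F' \<theta>' y' \<le> lagrange_dual F' Y \<theta>' \<phi>'"
      using less.hyps by blast
    have neighbors_F': "neighbors F' x = neighbors F x - (if x = u then {v} else if x = v then {u} else {})"
      for x
      using nodes(3) by (auto simp: neighbors_def adjacent_def F'_def)
    \<comment> \<open>The whole cost of \<open>v\<close> is moved onto the edge and \<open>m\<close>
      is moved from the edge to \<open>u\<close>. The edge cost becomes
      \<open>c s t + node_cost \<theta> v t - m s\<close>, nonnegative by the choice of
      \<open>m\<close>, and the node costs become those of \<open>\<theta>'\<close> reparametrized
      by \<open>\<phi>'\<close>.\<close>
    define \<phi> where "\<phi> x z = (if x = u \<and> z = v then (\<lambda>s. - m s)
      else if x = v \<and> z = u then node_cost \<theta> v else \<phi>' x z)" for x z
    have m_le: "m s \<le> c s t + node_cost \<theta> v t" if "t \<in> Y v" for s t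
      using that Y[OF nodes(2)] by (simp add: m_def)
    have edge: "edge_cost (reparametrize F \<theta> \<phi>) (x, z) p
        = edge_cost (reparametrize (delete_edge F u v) \<theta>' \<phi>') (x, z) p"
      if xz: "(x, z) \<in> edges (delete_edge F u v)" for x z p
    proof -
      have ne: "\<not> (x = u \<and> z = v)" "\<not> (x = v \<and> z = u)" using xz by simp_all
      then have "\<phi> x z = \<phi>' x z" by (simp only: \<phi>_def if_False)
      moreover have "\<phi> z x = \<phi>' z x" using ne by (simp only: \<phi>_def conj_commute if_False)
      ultimately show ?thesis by (cases p) (simp add: reparametrize_def \<theta>'_def)
    qed
    have "lagrange_dual (delete_edge F u v) Y \<theta>' \<phi>' \<le> lagrange_dual F Y \<theta> \<phi>"
    proof (rule lagrange_dual_delete_edge_le[OF less.prems(1) uv])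
      show "0 \<le> oriented_edge_cost F \<theta> u v s t + \<phi> u v s + \<phi> v u t" if "s \<in> Y u" "t \<in> Y v" for s t
        using m_le[OF that(2), of s] nodes(3) by (simp add: \<phi>_def flip: c_def)
      show "node_cost (reparametrize F \<theta> \<phi>) x s
          = node_cost (reparametrize (delete_edge F u v) \<theta>' \<phi>') x s" if "x \<in> nodes F" for x s
      proof -
        consider "x = v" | "x = u" | "x \<noteq> u" "x \<noteq> v" by blast
        then have "node_cost \<theta> x s - (\<Sum>z\<in>neighbors F x. \<phi> x z s)
            = node_cost \<theta>' x s - (\<Sum>z\<in>neighbors F' x. \<phi>' x z s)"
        proof cases
          case 1
          then show ?thesis using nodes(3) by (simp add: neighbors_F' nv \<theta>'_def \<phi>_def)
        next
          case 2
          have "(\<Sum>z\<in>neighbors F u. \<phi> u z s) = \<phi> u v s + (\<Sum>z\<in>neighbors F u - {v}. \<phi> u z s)"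
            using uv by (intro sum.remove finite_neighbors[OF F]) (simp add: neighbors_def)
          also have "(\<Sum>z\<in>neighbors F u - {v}. \<phi> u z s) = (\<Sum>z\<in>neighbors F u - {v}. \<phi>' u z s)"
            using nodes(3) by (intro sum.cong) (auto simp: \<phi>_def)
          finally show ?thesis using 2 nodes(3) by (simp add: neighbors_F' \<theta>'_def \<phi>_def)
        next
          case 3
          then show ?thesis by (simp add: neighbors_F' \<theta>'_def \<phi>_def)
        qed
        then show ?thesis by (simp add: reparametrize_def F'_def)
      qed
    qed (rule edge)
    moreover have "\<exists>y. y \<in> PiE (nodes F) Y \<and> energy F \<theta> y = energy F' \<theta>' y'"
    proof -
      have "m (y' u) \<in> (\<lambda>t. c (y' u) t + node_cost \<theta> v t) ` Y v"
        unfolding m_def using Y[OF nodes(2)] by (intro Min_in) auto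
      then obtain t where t: "t \<in> Y v" "m (y' u) = c (y' u) t + node_cost \<theta> v t" by blast
      \<comment> \<open>In \<open>F'\<close> the node \<open>v\<close> is isolated with zero cost,
        so its label may be replaced by a \<open>t\<close> attaining the message; adding the edge
        and the cost of \<open>v\<close> then restores exactly \<open>m (y' u)\<close>.\<close>
      define y where "y = y'(v := t)"
      have "y \<in> PiE (nodes F) Y"
        using y' t(1) nodes(2) by (auto simp: y_def nodes_F' PiE_iff extensional_def)
      moreover have "energy F' \<theta> y = energy F' \<theta>' y' - m (y' u) + node_cost \<theta> v t"
      proof -
        have fin: "finite (nodes F)" using F by (simp add: finite_simple_graph_def)
        have E: "(\<Sum>(x, z)\<in>edges F'. edge_cost \<theta> (x, z) (y x, y z))
            = (\<Sum>(x, z)\<in>edges F'. edge_cost \<theta>' (x, z) (y' x, y' z))"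
        proof (intro sum.cong refl, clarify)
          fix x z assume xz: "(x, z) \<in> edges F'"
          then have "z \<in> neighbors F' x" "x \<in> neighbors F' z"
            by (auto simp: neighbors_def adjacent_def)
          then have "x \<noteq> v" "z \<noteq> v" using nodes(3) by (auto simp: neighbors_F' nv split: if_splits)
          then show "edge_cost \<theta> (x, z) (y x, y z) = edge_cost \<theta>' (x, z) (y' x, y' z)"
            by (simp add: y_def \<theta>'_def)
        qed
        have split: "(\<Sum>x\<in>nodes F. f x) = f u + (f v + (\<Sum>x\<in>nodes F - {u} - {v}. f x))"
          for f :: "'a \<Rightarrow> real"
          using fin nodes by (simp add: sum.remove[of "nodes F" u] sum.remove[of "nodes F - {u}" v])
        have N: "(\<Sum>x\<in>nodes F - {u} - {v}. node_cost \<theta> x (y x))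
            = (\<Sum>x\<in>nodes F - {u} - {v}. node_cost \<theta>' x (y' x))"
          by (intro sum.cong) (auto simp: y_def \<theta>'_def)
        show ?thesis
          unfolding energy_def E nodes_F' split N using nodes(3) by (simp add: y_def \<theta>'_def)
      qed
      moreover have "energy F \<theta> y = energy F' \<theta> y + c (y' u) t"
        using energy_delete_edge[OF F uv, of \<theta> y] nodes(3) by (simp add: F'_def c_def y_def)
      ultimately show ?thesis using t(2) by (intro exI[of _ y]) simp
    qed
    ultimately show ?thesis using le by (metis F'_def order_trans)
  qed
qed

section \<open>Attainment of the maximum\<close>

definition affine_on :: "'j set \<Rightarrow> (('j \<Rightarrow> real) \<Rightarrow> real) \<Rightarrow> bool" where
  "affine_on J g \<longleftrightarrow> (\<exists>c d. \<forall>x. g x = d + (\<Sum>j\<in>J. c j * x j))"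

text \<open>Concave piecewise affine functions of the finitely many coordinates in \<open>J\<close>.
  The pieces form a set of functions, so that coordinates can be eliminated by replacing this
  set.\<close>

definition min_affine_on :: "'j set \<Rightarrow> (('j \<Rightarrow> real) \<Rightarrow> real) \<Rightarrow> bool" where
  "min_affine_on J h \<longleftrightarrow>
     (\<exists>S. finite S \<and> S \<noteq> {} \<and> (\<forall>g\<in>S. affine_on J g) \<and> (\<forall>x. h x = (MIN g\<in>S. g x)))"

section \<open>Closure properties of affine functions and their minima\<close>

lemma affine_onI: "(\<And>x. g x = d + (\<Sum>j\<in>J. c j * x j)) \<Longrightarrow> affine_on J g"
  unfolding affine_on_def by blast

lemma affine_on_const: "affine_on J (\<lambda>x. d)"
  by (rule affine_onI[where c = "\<lambda>_. 0" and d = d]) simp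

lemma affine_on_coordinate:
  assumes "finite J" "k \<in> J"
  shows "affine_on J (\<lambda>x. x k)"
proof -
  have "x k = 0 + (\<Sum>j\<in>J. of_bool (j = k) * x j)" for x :: "'a \<Rightarrow> real"
    using assms by (simp add: of_bool_def if_distrib[of "\<lambda>a. a * _"] cong: if_cong)
  then show ?thesis by (rule affine_onI)
qed

lemma affine_on_add:
  assumes "affine_on J f" "affine_on J g"
  shows "affine_on J (\<lambda>x. f x + g x)"
proof -
  obtain c d c' d' where "\<forall>x. f x = d + (\<Sum>j\<in>J. c j * x j)" "\<forall>x. g x = d' + (\<Sum>j\<in>J. c' j * x j)"
    using assms unfolding affine_on_def by blast
  then have "f x + g x = (d + d') + (\<Sum>j\<in>J. (c j + c' j) * x j)" for x
    by (simp add: sum.distrib algebra_simps)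
  then show ?thesis by (rule affine_onI)
qed

lemma affine_on_mult:
  assumes "affine_on J g"
  shows "affine_on J (\<lambda>x. a * g x)"
proof -
  obtain c d where "\<forall>x. g x = d + (\<Sum>j\<in>J. c j * x j)"
    using assms unfolding affine_on_def by blast
  then have "a * g x = a * d + (\<Sum>j\<in>J. (a * c j) * x j)" for x
    by (simp add: sum_distrib_left algebra_simps)
  then show ?thesis by (rule affine_onI)
qed

lemma affine_on_diff:
  assumes "affine_on J f" "affine_on J g"
  shows "affine_on J (\<lambda>x. f x - g x)"
  using affine_on_add[OF assms(1) affine_on_mult[OF assms(2), of "-1"]] by simp

lemma affine_on_sum:
  assumes "\<And>i. i \<in> I \<Longrightarrow> affine_on J (f i)"
  shows "affine_on J (\<lambda>x. \<Sum>i\<in>I. f i x)"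
  using assms
  by (induction I rule: infinite_finite_induct) (auto intro: affine_on_const affine_on_add)

text \<open>Splitting off the summand of \<open>k\<close>: the slope \<open>a\<close> along this
  axis is constant, and only the intercept \<open>b x\<close> depends on the other
  coordinates.\<close>

lemma affine_on_insert:
  assumes "affine_on (insert k J) g" "finite J" "k \<notin> J"
  shows "\<exists>a b. affine_on J b \<and> (\<forall>x r. g (x(k := r)) = b x + a * r)"
proof -
  obtain c d where g: "\<And>x. g x = d + (\<Sum>j\<in>insert k J. c j * x j)"
    using assms unfolding affine_on_def by blast
  have "(\<Sum>j\<in>J. c j * (x(k := r)) j) = (\<Sum>j\<in>J. c j * x j)" for x r
    using assms(3) by (intro sum.cong) auto
  then have "g (x(k := r)) = (d + (\<Sum>j\<in>J. c j * x j)) + c k * r" for x r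
    using assms(2,3) by (simp add: g)
  moreover have "affine_on J (\<lambda>x. d + (\<Sum>j\<in>J. c j * x j))" by (rule affine_onI) simp
  ultimately show ?thesis by blast
qed

lemma min_affine_on_MIN:
  assumes "finite I" "I \<noteq> {}" "\<And>i. i \<in> I \<Longrightarrow> affine_on J (f i)"
  shows "min_affine_on J (\<lambda>x. MIN i\<in>I. f i x)"
  unfolding min_affine_on_def
  by (rule exI[of _ "f ` I"]) (use assms in \<open>auto simp: image_image\<close>)

lemma min_affine_on_const: "min_affine_on J (\<lambda>x. d)"
  using min_affine_on_MIN[of "{()}" J "\<lambda>_ _. d"] by (simp add: affine_on_const)

text \<open>The two minima are taken over independent indices, so their sum is one minimum over
  pairs of pieces.\<close>

lemma min_affine_on_add:
  assumes "min_affine_on J f" "min_affine_on J g"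
  shows "min_affine_on J (\<lambda>x. f x + g x)"
proof -
  obtain S where S: "finite S" "S \<noteq> {}" "\<forall>g\<in>S. affine_on J g" "\<forall>x. f x = (MIN g\<in>S. g x)"
    using assms(1) unfolding min_affine_on_def by blast
  obtain S' where S': "finite S'" "S' \<noteq> {}" "\<forall>g\<in>S'. affine_on J g" "\<forall>x. g x = (MIN g\<in>S'. g x)"
    using assms(2) unfolding min_affine_on_def by blast
  have "f x + g x = (MIN p\<in>S \<times> S'. fst p x + snd p x)" for x
  proof (rule sym, rule Min_eqI)
    show "finite ((\<lambda>p. fst p x + snd p x) ` (S \<times> S'))" using S S' by simp
    show "f x + g x \<le> z" if "z \<in> (\<lambda>p. fst p x + snd p x) ` (S \<times> S')" for z
      using that S S' by (auto intro!: add_mono)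
    have "f x \<in> (\<lambda>g. g x) ` S" "g x \<in> (\<lambda>g. g x) ` S'"
      using S S' by (auto intro!: Min_in simp del: Min_in)
    then show "f x + g x \<in> (\<lambda>p. fst p x + snd p x) ` (S \<times> S')" by force
  qed
  moreover have "min_affine_on J (\<lambda>x. MIN p\<in>S \<times> S'. fst p x + snd p x)"
    using S S' by (intro min_affine_on_MIN affine_on_add) auto
  ultimately show ?thesis by simp
qed

lemma min_affine_on_sum:
  assumes "\<And>i. i \<in> I \<Longrightarrow> min_affine_on J (f i)"
  shows "min_affine_on J (\<lambda>x. \<Sum>i\<in>I. f i x)"
  using assms
  by (induction I rule: infinite_finite_induct) (auto intro: min_affine_on_const min_affine_on_add)

text \<open>Rising lines bound \<open>r\<close> from below and falling lines bound it from above.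
  Hypothesis \<open>cross\<close>, with denominators cleared, says that a rising and a falling line
  meet at height at least \<open>m\<close>; hence every lower bound is at most every upper
  bound.\<close>

lemma line_separates:
  fixes a b :: "'i \<Rightarrow> real"
  assumes fin: "finite I"
    and zero: "\<And>i. i \<in> I \<Longrightarrow> a i = 0 \<Longrightarrow> m \<le> b i"
    and cross: "\<And>i j. i \<in> I \<Longrightarrow> j \<in> I \<Longrightarrow> a i > 0 \<Longrightarrow> a j < 0 \<Longrightarrow>
      m * (a i - a j) \<le> a i * b j - a j * b i"
  shows "\<exists>r. \<forall>i\<in>I. m \<le> b i + a i * r"
proof -
  define L where "L = (\<lambda>i. (m - b i) / a i) ` {i \<in> I. a i > 0}"
  define U where "U = (\<lambda>i. (m - b i) / a i) ` {i \<in> I. a i < 0}"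
  have finLU: "finite L" "finite U" using fin by (auto simp: L_def U_def)
  have LU: "l \<le> u" if lu: "l \<in> L" "u \<in> U" for l u
  proof -
    obtain i j where ij: "i \<in> I" "a i > 0" "l = (m - b i) / a i" "j \<in> I" "a j < 0" "u = (m - b j) / a j"
      using lu by (auto simp: L_def U_def)
    have "m * (a i - a j) \<le> a i * b j - a j * b i" using cross ij by blast
    moreover have "b i = m - l * a i" "b j = m - u * a j" using ij by (simp_all add: field_simps)
    ultimately have "(a i * - a j) * l \<le> (a i * - a j) * u" by (simp add: algebra_simps)
    moreover have "a i * - a j > 0" using ij by (simp add: mult_pos_neg)
    ultimately show ?thesis by (rule mult_left_le_imp_le)
  qed
  \<comment> \<open>The largest lower bound serves as \<open>r\<close>; if there is none, the least
    upper bound does, and if that is missing too, any number.\<close>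
  have "\<exists>r. (\<forall>l\<in>L. l \<le> r) \<and> (\<forall>u\<in>U. r \<le> u)"
  proof (cases "L = {}")
    case True
    then show ?thesis using finLU by (cases "U = {}") (auto intro!: exI[of _ "Min U"])
  next
    case False
    then show ?thesis using finLU LU by (intro exI[of _ "Max L"]) auto
  qed
  then obtain r where r: "\<forall>l\<in>L. l \<le> r" "\<forall>u\<in>U. r \<le> u" by blast
  have "m \<le> b i + a i * r" if i: "i \<in> I" for i
  proof -
    consider "a i = 0" | "a i > 0" | "a i < 0" by linarith
    then show ?thesis
    proof cases
      case 1 then show ?thesis using zero i by simp
    next
      case 2
      then have "(m - b i) / a i \<le> r" using r i by (auto simp: L_def)
      then show ?thesis using 2 by (simp add: field_simps)
    next
      case 3
      then have "r \<le> (m - b i) / a i" using r i by (auto simp: U_def)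
      then show ?thesis using 3 by (simp add: field_simps)
    qed
  qed
  then show ?thesis by blast
qed

text \<open>
  Fourier-Motzkin elimination of the coordinate \<open>k\<close>. Along the \<open>k\<close>-axis the pieces are lines of
  slope \<open>a g\<close>; boundedness excludes that all slopes are positive or all are negative, and the
  maximum over the axis is the least of the horizontal lines and of the crossing heights of an
  increasing with a decreasing line.
\<close>

lemma min_affine_on_eliminate:
  assumes h: "min_affine_on (insert k J) h" and J: "finite J" "k \<notin> J" and bound: "\<And>x. h x \<le> M"
  shows "\<exists>h'. min_affine_on J h' \<and> (\<forall>x. (\<forall>r. h (x(k := r)) \<le> h' x) \<and> (\<exists>r. h' x = h (x(k := r))))"
proof -
  obtain S where S: "finite S" "S \<noteq> {}" "\<forall>g\<in>S. affine_on (insert k J) g"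
    and hS: "\<And>x. h x = (MIN g\<in>S. g x)"
    using h unfolding min_affine_on_def by blast
  have "\<forall>g\<in>S. \<exists>a b. affine_on J b \<and> (\<forall>x r. g (x(k := r)) = b x + a * r)"
    using S(3) J by (blast intro: affine_on_insert)
  then obtain a b where b: "\<And>g. g \<in> S \<Longrightarrow> affine_on J (b g)"
    and g_eq: "\<And>g x r. g \<in> S \<Longrightarrow> g (x(k := r)) = b g x + a g * r"
    by metis
  \<comment> \<open>\<open>w p x\<close> is the height at which the lines of \<open>fst p\<close>
    and \<open>snd p\<close> cross.\<close>
  define w where "w p = (\<lambda>x. (a (fst p) * b (snd p) x - a (snd p) * b (fst p) x) / (a (fst p) - a (snd p)))"
    for p
  define I where "I = {p \<in> S \<times> S. a (fst p) > 0 \<and> a (snd p) < 0}"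
  define S' where "S' = b ` {g \<in> S. a g = 0} \<union> w ` I"
  have w: "w p x * (a (fst p) - a (snd p)) = a (fst p) * b (snd p) x - a (snd p) * b (fst p) x"
    if "p \<in> I" for p x
    using that by (auto simp: w_def I_def)
  have finS': "finite S'" using S(1) by (auto simp: S'_def I_def)
  have hle: "h (x(k := r)) \<le> b g x + a g * r" if "g \<in> S" for g x r
    using S(1) that by (simp add: hS flip: g_eq)
  have le: "h (x(k := r)) \<le> z x" if z: "z \<in> S'" for z x r
  proof -
    consider g where "g \<in> S" "a g = 0" "z = b g" | p where "p \<in> I" "z = w p"
      using z by (auto simp: S'_def)
    then show ?thesis
    proof cases
      case 1 then show ?thesis using hle[of g x r] by simp
    next
      case (2 p)
      define i j where "i = fst p" "j = snd p"
      have ij: "i \<in> S" "j \<in> S" "a i > 0" "a j < 0" using 2 by (auto simp: I_def i_j_def)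
      \<comment> \<open>The crossing height is the convex combination of the two lines with weights
        proportional to \<open>a i\<close> and \<open>- a j\<close>, in which the terms in
        \<open>r\<close> cancel.\<close>
      have "a i * h (x(k := r)) \<le> a i * (b j x + a j * r)"
        using ij hle[of j x r] by (intro mult_left_mono) auto
      moreover have "- a j * h (x(k := r)) \<le> - a j * (b i x + a i * r)"
        using ij hle[of i x r] by (intro mult_left_mono) auto
      ultimately have "h (x(k := r)) * (a i - a j) \<le> z x * (a i - a j)"
        using w[OF 2(1), of x] 2(2) by (simp add: i_j_def algebra_simps)
      then show ?thesis using ij by simp
    qed
  qed
  have ex: "\<exists>r. m \<le> h (x(k := r))" if m: "\<And>z. z \<in> S' \<Longrightarrow> m \<le> z x" for m x
  proof -
    have "\<exists>r. \<forall>g\<in>S. m \<le> b g x + a g * r"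
    proof (rule line_separates[OF S(1)])
      show "m \<le> b g x" if "g \<in> S" "a g = 0" for g
        using that by (intro m) (auto simp: S'_def)
      show "m * (a i - a j) \<le> a i * b j x - a j * b i x"
        if "i \<in> S" "j \<in> S" "a i > 0" "a j < 0" for i j
      proof -
        have p: "(i, j) \<in> I" using that by (simp add: I_def)
        then have "m \<le> w (i, j) x" by (intro m) (auto simp: S'_def)
        then have "m * (a i - a j) \<le> w (i, j) x * (a i - a j)"
          using that by (intro mult_right_mono) auto
        then show ?thesis using w[OF p, of x] by simp
      qed
    qed
    then show ?thesis using S by (auto simp: hS g_eq)
  qed
  \<comment> \<open>If \<open>S'\<close> were empty, \<open>ex\<close> would hold vacuously for
    \<open>M + 1\<close> and give a value of \<open>h\<close> above \<open>M\<close>.\<close>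
  have neS': "S' \<noteq> {}" using ex[of "M + 1"] bound by (metis add_le_same_cancel1 empty_iff not_one_le_zero order_trans)
  have "affine_on J z" if "z \<in> S'" for z
  proof -
    have "affine_on J (w p)" if "p \<in> I" for p
    proof -
      have "affine_on J (\<lambda>x. inverse (a (fst p) - a (snd p)) *
          (a (fst p) * b (snd p) x - a (snd p) * b (fst p) x))"
        using that by (intro affine_on_mult affine_on_diff b) (auto simp: I_def)
      then show ?thesis by (simp add: w_def divide_inverse mult.commute)
    qed
    then show ?thesis using that b by (auto simp: S'_def)
  qed
  then have "min_affine_on J (\<lambda>x. MIN z\<in>S'. z x)"
    using min_affine_on_MIN[OF finS' neS', of J "\<lambda>z. z"] by blast
  moreover have up: "h (x(k := r)) \<le> (MIN z\<in>S'. z x)" for x r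
    using finS' neS' le by simp
  moreover have "\<exists>r. (MIN z\<in>S'. z x) = h (x(k := r))" for x
    using ex[of "MIN z\<in>S'. z x" x] finS' up by (force intro: antisym)
  ultimately show ?thesis by blast
qed

text \<open>Coordinates are maximized out one at a time. The bound survives because every value of
  \<open>h'\<close> is a value of \<open>h\<close>; without coordinates \<open>h\<close> is
  constant.\<close>

lemma min_affine_on_attains_max:
  assumes "finite J" "min_affine_on J h" "\<And>x. h x \<le> M"
  shows "\<exists>x. \<forall>x'. h x' \<le> h x"
  using assms
proof (induction J arbitrary: h rule: finite_induct)
  case empty
  then have "h x' = h x" for x x'
    unfolding min_affine_on_def affine_on_def
    by (metis (mono_tags, lifting) image_cong sum.empty)
  then show ?case by (metis order_refl)
next
  case (insert k J)
  obtain h' where h': "min_affine_on J h'" "\<And>x r. h (x(k := r)) \<le> h' x"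
    "\<And>x. \<exists>r. h' x = h (x(k := r))"
    using min_affine_on_eliminate[OF insert.prems(1) insert.hyps insert.prems(2)] by metis
  have "h' x \<le> M" for x using h'(3)[of x] insert.prems(2) by metis
  then obtain x where x: "\<And>x'. h' x' \<le> h' x" using insert.IH[OF h'(1)] by blast
  obtain r where r: "h' x = h (x(k := r))" using h'(3) by blast
  have "h x' \<le> h' x" for x' using h'(2)[of x' "x' k"] x[of x'] by simp
  then show ?case using r by metis
qed

lemma lagrange_dual_attains_max:
  assumes G: "graphical_model G Y"
  shows "\<exists>\<phi>. \<forall>\<phi>'. lagrange_dual G Y \<theta> \<phi>' \<le> lagrange_dual G Y \<theta> \<phi>"
proof -
  have graph: "finite_simple_graph G" using G by (simp add: graphical_model_def)
  have Y: "finite (Y x)" "Y x \<noteq> {}" if "x \<in> nodes G" for x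
    using G that by (auto simp: graphical_model_def)
  have E: "x \<in> nodes G" "z \<in> nodes G" if "(x, z) \<in> edges G" for x z
    using graph that by (auto simp: finite_simple_graph_def)
  \<comment> \<open>A finite index set containing all the dual variables that occur; pooling the
    labels of all nodes makes it a plain product.\<close>
  define J where "J = nodes G \<times> nodes G \<times> (\<Union>x\<in>nodes G. Y x)"
  define curried :: "('a \<times> 'a \<times> 'b \<Rightarrow> real) \<Rightarrow> 'a \<Rightarrow> 'a \<Rightarrow> 'b \<Rightarrow> real"
    where "curried x = (\<lambda>u v s. x (u, v, s))" for x
  have fin: "finite J" using graph Y by (auto simp: J_def finite_simple_graph_def)
  define h where "h x = lagrange_dual G Y \<theta> (curried x)" for x
  have "min_affine_on J h"
    unfolding h_def lagrange_dual_def
  proof (intro min_affine_on_add min_affine_on_sum)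
    fix u assume u: "u \<in> nodes G"
    show "min_affine_on J (\<lambda>x. MIN s\<in>Y u. node_cost (reparametrize G \<theta> (curried x)) u s)"
      using Y[OF u] u neighbors_subset_nodes[OF graph, of u]
      by (intro min_affine_on_MIN)
        (auto simp: reparametrize_def curried_def J_def[symmetric]
          intro!: affine_on_diff affine_on_const affine_on_sum affine_on_coordinate fin, auto simp: J_def)
  next
    fix e assume e: "e \<in> edges G"
    obtain u v where uv: "e = (u, v)" by (cases e)
    have "min_affine_on J (\<lambda>x. MIN p\<in>Y u \<times> Y v. edge_cost (reparametrize G \<theta> (curried x)) (u, v) p)"
      using e Y E uv
      by (intro min_affine_on_MIN)
        (auto simp: reparametrize_def curried_def
          intro!: affine_on_add affine_on_const affine_on_coordinate fin, auto simp: J_def)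
    then show "min_affine_on J (\<lambda>x. case e of (u, v) \<Rightarrow>
        MIN p\<in>Y u \<times> Y v. edge_cost (reparametrize G \<theta> (curried x)) (u, v) p)"
      by (simp add: uv)
  qed
  \<comment> \<open>By weak duality the energy of one fixed labeling bounds the dual from
    above.\<close>
  moreover have "h x \<le> energy G \<theta> (\<lambda>u. SOME s. s \<in> Y u)" for x
    unfolding h_def using Y by (intro lagrange_dual_le_energy[OF G]) (simp add: some_in_eq)
  ultimately obtain x where x: "\<And>x'. h x' \<le> h x"
    using min_affine_on_attains_max[OF fin] by metis
  have "\<phi> = curried (\<lambda>(u, v, s). \<phi> u v s)" for \<phi> by (simp add: curried_def)
  then show ?thesis using x unfolding h_def by metis
qed

section \<open>Comparison of the two duals\<close>

lemma sum_swap_subsets: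
  fixes f :: "'i \<Rightarrow> 'j \<Rightarrow> 'a::comm_monoid_add"
  assumes "finite I" "finite J" "\<And>i. i \<in> I \<Longrightarrow> A i \<subseteq> J"
  shows "(\<Sum>i\<in>I. \<Sum>j\<in>A i. f i j) = (\<Sum>j\<in>J. \<Sum>i\<in>{i\<in>I. j \<in> A i}. f i j)"
proof -
  have "(\<Sum>i\<in>I. \<Sum>j\<in>A i. f i j) = (\<Sum>i\<in>I. \<Sum>j\<in>{j\<in>J. j \<in> A i}. f i j)"
    using assms(3) by (intro sum.cong) auto
  also have "\<dots> = (\<Sum>j\<in>J. \<Sum>i\<in>{i\<in>I. j \<in> A i}. f i j)"
    using assms(1,2) by (rule sum.swap_restrict)
  finally show ?thesis .
qed

text \<open>On the left each summand may choose its own minimizer, on the right all share one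
  \<open>s\<close>.\<close>

lemma sum_MIN_le_MIN_sum:
  fixes f :: "'i \<Rightarrow> 's \<Rightarrow> real"
  assumes "finite S" "S \<noteq> {}" "\<And>s. s \<in> S \<Longrightarrow> g s = (\<Sum>i\<in>I. f i s)"
  shows "(\<Sum>i\<in>I. MIN s\<in>S. f i s) \<le> (MIN s\<in>S. g s)"
  using assms by (auto intro!: sum_mono)

section \<open>A model with a fixed decomposition\<close>

context
  fixes G :: "'v graph" and Y :: "'v \<Rightarrow> 'l set" and \<theta> :: "('v, 'l) costs"
    and T :: "'t set" and H :: "'t \<Rightarrow> 'v graph"
  assumes model: "graphical_model G Y" and decomp: "decomposition G T H"
begin

lemma graph: "finite_simple_graph G"
  using model by (simp add: graphical_model_def)

lemma labels: "u \<in> nodes G \<Longrightarrow> finite (Y u)" "u \<in> nodes G \<Longrightarrow> Y u \<noteq> {}"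
  using model by (auto simp: graphical_model_def)

lemma edge_nodes:
  "(u, v) \<in> edges G \<Longrightarrow> u \<in> nodes G" "(u, v) \<in> edges G \<Longrightarrow> v \<in> nodes G"
  using graph by (auto simp: finite_simple_graph_def)

lemma finite_T: "finite T"
  using decomp by (simp add: decomposition_def)

lemma slave_subgraph: "\<tau> \<in> T \<Longrightarrow> subgraph (H \<tau>) G"
  using decomp by (simp add: decomposition_def)

lemma slave_model: "\<tau> \<in> T \<Longrightarrow> graphical_model (H \<tau>) Y"
  using graphical_model_subgraph[OF model slave_subgraph] .

lemma slave_graph: "\<tau> \<in> T \<Longrightarrow> finite_simple_graph (H \<tau>)"
  using slave_model by (simp add: graphical_model_def)

lemma finite_PiE_slave: "\<tau> \<in> T \<Longrightarrow> finite (PiE (nodes (H \<tau>)) Y)"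
  using slave_model by (auto simp: graphical_model_def finite_simple_graph_def intro!: finite_PiE)

lemma PiE_slave_ne: "\<tau> \<in> T \<Longrightarrow> PiE (nodes (H \<tau>)) Y \<noteq> {}"
  using slave_model by (auto simp: graphical_model_def PiE_eq_empty_iff)

text \<open>A slave inherits the stored order of its edges from \<open>G\<close>, so adjacency in
  either direction means that this one pair is present.\<close>

lemma adjacent_slave:
  assumes "\<tau> \<in> T" "(u, v) \<in> edges G"
  shows "adjacent (H \<tau>) u v \<longleftrightarrow> (u, v) \<in> edges (H \<tau>)" "adjacent (H \<tau>) v u \<longleftrightarrow> (u, v) \<in> edges (H \<tau>)"
  using slave_subgraph[OF assms(1)] assms(2) graph
  by (auto simp: adjacent_def subgraph_def finite_simple_graph_def)

lemma sum_slave_nodes: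
  fixes f :: "'t \<Rightarrow> 'v \<Rightarrow> real"
  shows "(\<Sum>\<tau>\<in>T. \<Sum>u\<in>nodes (H \<tau>). f \<tau> u) = (\<Sum>u\<in>nodes G. \<Sum>\<tau>\<in>{\<tau>\<in>T. u \<in> nodes (H \<tau>)}. f \<tau> u)"
  using graph slave_subgraph
  by (intro sum_swap_subsets finite_T) (auto simp: finite_simple_graph_def subgraph_def)

lemma sum_slave_edges:
  fixes f :: "'t \<Rightarrow> 'v \<times> 'v \<Rightarrow> real"
  shows "(\<Sum>\<tau>\<in>T. \<Sum>e\<in>edges (H \<tau>). f \<tau> e) = (\<Sum>e\<in>edges G. \<Sum>\<tau>\<in>{\<tau>\<in>T. e \<in> edges (H \<tau>)}. f \<tau> e)"
  using slave_subgraph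
  by (intro sum_swap_subsets finite_T finite_edges[OF graph]) (auto simp: subgraph_def)

text \<open>A slave in which \<open>u\<close> has a neighbor contains \<open>u\<close>, so after the
  exchange only adjacency remains as a condition on \<open>\<tau>\<close>.\<close>

lemma sum_slave_neighbors:
  fixes f :: "'t \<Rightarrow> 'v \<Rightarrow> real"
  shows "(\<Sum>\<tau>\<in>{\<tau>\<in>T. u \<in> nodes (H \<tau>)}. \<Sum>v\<in>neighbors (H \<tau>) u. f \<tau> v)
    = (\<Sum>v\<in>neighbors G u. \<Sum>\<tau>\<in>{\<tau>\<in>T. adjacent (H \<tau>) u v}. f \<tau> v)"
proof -
  have "neighbors (H \<tau>) u \<subseteq> neighbors G u" if "\<tau> \<in> T" for \<tau>
    using slave_subgraph[OF that] by (auto simp: subgraph_def neighbors_def adjacent_def)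
  then have "(\<Sum>\<tau>\<in>{\<tau>\<in>T. u \<in> nodes (H \<tau>)}. \<Sum>v\<in>neighbors (H \<tau>) u. f \<tau> v)
    = (\<Sum>v\<in>neighbors G u. \<Sum>\<tau>\<in>{\<tau>\<in>{\<tau>\<in>T. u \<in> nodes (H \<tau>)}. v \<in> neighbors (H \<tau>) u}. f \<tau> v)"
    using finite_T finite_neighbors[OF graph] by (intro sum_swap_subsets) auto
  moreover have "{\<tau>\<in>{\<tau>\<in>T. u \<in> nodes (H \<tau>)}. v \<in> neighbors (H \<tau>) u} = {\<tau>\<in>T. adjacent (H \<tau>) u v}" for v
    using adjacent_nodes(1)[OF slave_graph] by (auto simp: neighbors_def)
  ultimately show ?thesis by simp
qed

lemma decomposition_dual_le_sum_energy:
  assumes "\<And>\<tau>. \<tau> \<in> T \<Longrightarrow> y \<tau> \<in> PiE (nodes (H \<tau>)) Y"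
  shows "decomposition_dual Y T H \<theta>T \<le> (\<Sum>\<tau>\<in>T. energy (H \<tau>) (\<theta>T \<tau>) (y \<tau>))"
  unfolding decomposition_dual_def using assms finite_PiE_slave by (intro sum_mono Min_le) auto

text \<open>Acyclicity enters here: each slave minimum is matched by a dual value of that slave, and
  merging the local minima of all slaves can only increase the total.\<close>

lemma decomposition_dual_le_lagrange_dual:
  assumes acyclic: "\<forall>\<tau>\<in>T. acyclic_graph (H \<tau>)" and slave: "\<theta>T \<in> slave_costs G Y \<theta> T H"
  shows "\<exists>\<phi>. decomposition_dual Y T H \<theta>T \<le> lagrange_dual G Y \<theta> \<phi>"
proof -
  have "\<forall>\<tau>\<in>T. \<exists>\<phi> y. y \<in> PiE (nodes (H \<tau>)) Y \<and>
      energy (H \<tau>) (\<theta>T \<tau>) y \<le> lagrange_dual (H \<tau>) Y (\<theta>T \<tau>) \<phi>"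
    using forest_tight slave_model acyclic by blast
  then obtain \<psi> y where y: "\<And>\<tau>. \<tau> \<in> T \<Longrightarrow> y \<tau> \<in> PiE (nodes (H \<tau>)) Y"
    and tight: "\<And>\<tau>. \<tau> \<in> T \<Longrightarrow> energy (H \<tau>) (\<theta>T \<tau>) (y \<tau>) \<le> lagrange_dual (H \<tau>) Y (\<theta>T \<tau>) (\<psi> \<tau>)"
    by metis
  \<comment> \<open>Reparametrization is linear in the costs and dual variables together, so with
    the summed \<open>\<psi>\<close> the reparametrized costs of \<open>G\<close> are the sums of
    those of the slaves.\<close>
  define \<phi> where "\<phi> u v s = (\<Sum>\<tau>\<in>{\<tau>\<in>T. adjacent (H \<tau>) u v}. \<psi> \<tau> u v s)" for u v s
  let ?R = "\<lambda>\<tau>. reparametrize (H \<tau>) (\<theta>T \<tau>) (\<psi> \<tau>)"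
  have node: "node_cost (reparametrize G \<theta> \<phi>) u s = (\<Sum>\<tau>\<in>{\<tau>\<in>T. u \<in> nodes (H \<tau>)}. node_cost (?R \<tau>) u s)"
    if "u \<in> nodes G" "s \<in> Y u" for u s
    using slave that
    by (simp add: reparametrize_def sum_subtractf sum_slave_neighbors slave_costs_def \<phi>_def)
  have edge: "edge_cost (reparametrize G \<theta> \<phi>) (u, v) p
      = (\<Sum>\<tau>\<in>{\<tau>\<in>T. (u, v) \<in> edges (H \<tau>)}. edge_cost (?R \<tau>) (u, v) p)"
    if uv: "(u, v) \<in> edges G" and p: "p \<in> Y u \<times> Y v" for u v p
  proof -
    have sets: "{\<tau>\<in>T. adjacent (H \<tau>) u v} = {\<tau>\<in>T. (u, v) \<in> edges (H \<tau>)}"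
      "{\<tau>\<in>T. adjacent (H \<tau>) v u} = {\<tau>\<in>T. (u, v) \<in> edges (H \<tau>)}"
      using adjacent_slave uv by blast+
    have "(\<Sum>\<tau>\<in>{\<tau>\<in>T. (u, v) \<in> edges (H \<tau>)}. edge_cost (\<theta>T \<tau>) (u, v) p) = edge_cost \<theta> (u, v) p"
      using slave uv p by (auto simp: slave_costs_def)
    then show ?thesis by (cases p) (simp add: reparametrize_def sum.distrib \<phi>_def sets)
  qed
  have "decomposition_dual Y T H \<theta>T \<le> (\<Sum>\<tau>\<in>T. lagrange_dual (H \<tau>) Y (\<theta>T \<tau>) (\<psi> \<tau>))"
    using decomposition_dual_le_sum_energy[OF y] sum_mono[OF tight] by (rule order_trans)
  also have "\<dots> = (\<Sum>u\<in>nodes G. \<Sum>\<tau>\<in>{\<tau>\<in>T. u \<in> nodes (H \<tau>)}. MIN s\<in>Y u. node_cost (?R \<tau>) u s) +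
      (\<Sum>(u, v)\<in>edges G. \<Sum>\<tau>\<in>{\<tau>\<in>T. (u, v) \<in> edges (H \<tau>)}. MIN p\<in>Y u \<times> Y v. edge_cost (?R \<tau>) (u, v) p)"
    by (simp add: lagrange_dual_def sum.distrib sum_slave_nodes sum_slave_edges case_prod_unfold)
  also have "\<dots> \<le> lagrange_dual G Y \<theta> \<phi>"
    unfolding lagrange_dual_def
  proof (intro add_mono sum_mono, goal_cases)
    case (1 u)
    then show ?case using labels node by (intro sum_MIN_le_MIN_sum) auto
  next
    case (2 e)
    obtain u v where "e = (u, v)" by (cases e)
    then show ?case using 2 labels edge_nodes[of u v]
      by (simp del: Min_ge_iff Min_le_iff, intro sum_MIN_le_MIN_sum edge) auto
  qed
  finally show ?thesis by blast
qed

text \<open>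
  The reparametrized costs are shared equally among the slaves containing the component; adding
  an equal share of \<open>\<phi>\<close> back in every slave restores the total cost \<open>\<theta>\<close> without changing the
  energies of the slaves.
\<close>

lemma lagrange_dual_le_decomposition_dual:
  "\<exists>\<theta>T\<in>slave_costs G Y \<theta> T H. lagrange_dual G Y \<theta> \<phi> \<le> decomposition_dual Y T H \<theta>T"
proof -
  define R where "R = reparametrize G \<theta> \<phi>"
  define n where "n u = real (card {\<tau>\<in>T. u \<in> nodes (H \<tau>)})" for u
  define k where "k e = real (card {\<tau>\<in>T. e \<in> edges (H \<tau>)})" for e
  define a where "a u v = real (card {\<tau>\<in>T. adjacent (H \<tau>) u v})" for u v
  have n: "n u > 0" if "u \<in> nodes G" for u
    using decomp that finite_T by (auto simp: n_def decomposition_def card_gt_0_iff)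
  have k: "k e > 0" if "e \<in> edges G" for e
  proof -
    have "\<exists>\<tau>\<in>T. e \<in> edges (H \<tau>)" using decomp that unfolding decomposition_def by simp
    then show ?thesis using finite_T by (auto simp: k_def card_gt_0_iff)
  qed
  have a: "a u v = k (u, v)" "a v u = k (u, v)" if "(u, v) \<in> edges G" for u v
  proof -
    have "{\<tau>\<in>T. adjacent (H \<tau>) u v} = {\<tau>\<in>T. (u, v) \<in> edges (H \<tau>)}"
      "{\<tau>\<in>T. adjacent (H \<tau>) v u} = {\<tau>\<in>T. (u, v) \<in> edges (H \<tau>)}"
      using adjacent_slave that by blast+
    then show "a u v = k (u, v)" "a v u = k (u, v)" by (simp_all add: a_def k_def)
  qed
  have a_pos: "a u v > 0" if "v \<in> neighbors G u" for u v
    using that a k by (force simp: neighbors_def adjacent_def)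
  define S where "S = \<lparr>node_cost = (\<lambda>u s. node_cost R u s / n u), edge_cost = (\<lambda>e p. edge_cost R e p / k e)\<rparr>"
  \<comment> \<open>Exactly \<open>a u v\<close> slaves contain the edge, so the shares of
    \<open>- \<phi>\<close> sum to \<open>- \<phi>\<close> and undo the reparametrization contained
    in \<open>R\<close>.\<close>
  define \<theta>T where "\<theta>T \<tau> = reparametrize (H \<tau>) S (\<lambda>u v s. - (\<phi> u v s / a u v))" for \<tau>
  have "\<theta>T \<in> slave_costs G Y \<theta> T H"
    unfolding slave_costs_def
  proof (intro CollectI conjI ballI, goal_cases)
    case (1 u s)
    have "(\<Sum>\<tau>\<in>{\<tau>\<in>T. u \<in> nodes (H \<tau>)}. node_cost (\<theta>T \<tau>) u s)
        = n u * (node_cost R u s / n u) + (\<Sum>v\<in>neighbors G u. a u v * (\<phi> u v s / a u v))"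
      by (simp add: \<theta>T_def S_def reparametrize_def sum_negf sum.distrib sum_slave_neighbors n_def a_def)
    also have "\<dots> = node_cost R u s + (\<Sum>v\<in>neighbors G u. \<phi> u v s)"
      using n[OF 1(1)] a_pos[of _ u] by (intro arg_cong2[where f = "(+)"] sum.cong) force+
    finally show ?case by (simp add: R_def reparametrize_def)
  next
    case (2 e)
    obtain u v where e: "e = (u, v)" by (cases e)
    have uv: "(u, v) \<in> edges G" using 2 e by simp
    have "(\<Sum>\<tau>\<in>{\<tau>\<in>T. (u, v) \<in> edges (H \<tau>)}. edge_cost (\<theta>T \<tau>) (u, v) (s, t)) = edge_cost \<theta> (u, v) (s, t)"
      for s t
    proof -
      have "edge_cost (\<theta>T \<tau>) (u, v) (s, t) = edge_cost \<theta> (u, v) (s, t) / k (u, v)" for \<tau>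
        using k[OF uv] by (simp add: \<theta>T_def S_def R_def reparametrize_def a[OF uv] field_simps)
      then have "(\<Sum>\<tau>\<in>{\<tau>\<in>T. (u, v) \<in> edges (H \<tau>)}. edge_cost (\<theta>T \<tau>) (u, v) (s, t))
          = k (u, v) * (edge_cost \<theta> (u, v) (s, t) / k (u, v))"
        by (simp add: k_def)
      then show ?thesis using k[OF uv] by simp
    qed
    then show ?case by (auto simp: e)
  qed
  moreover have "lagrange_dual G Y \<theta> \<phi> \<le> decomposition_dual Y T H \<theta>T"
  proof -
    let ?N = "\<lambda>u. MIN s\<in>Y u. node_cost R u s" and ?E = "\<lambda>e. MIN p\<in>Y (fst e) \<times> Y (snd e). edge_cost R e p"
    \<comment> \<open>Each local minimum is split into one equal share per slave containing the
      component; the multiplicities are positive because the slaves cover \<open>G\<close>.\<close>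
    have "lagrange_dual G Y \<theta> \<phi> = (\<Sum>u\<in>nodes G. n u * (?N u / n u)) + (\<Sum>e\<in>edges G. k e * (?E e / k e))"
      unfolding lagrange_dual_def R_def[symmetric] using n k
      by (intro arg_cong2[where f = "(+)"] sum.cong refl) (force simp: case_prod_unfold)+
    also have "\<dots> = (\<Sum>\<tau>\<in>T. (\<Sum>u\<in>nodes (H \<tau>). ?N u / n u) + (\<Sum>e\<in>edges (H \<tau>). ?E e / k e))"
      by (simp add: sum.distrib sum_slave_nodes sum_slave_edges n_def k_def)
    also have "\<dots> \<le> decomposition_dual Y T H \<theta>T"
      unfolding decomposition_dual_def
    proof (rule sum_mono)
      fix \<tau> assume \<tau>: "\<tau> \<in> T"
      have sub: "nodes (H \<tau>) \<subseteq> nodes G" "edges (H \<tau>) \<subseteq> edges G" "edges (H \<tau>) \<subseteq> nodes (H \<tau>) \<times> nodes (H \<tau>)"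
        using slave_subgraph[OF \<tau>] by (auto simp: subgraph_def)
      have "(\<Sum>u\<in>nodes (H \<tau>). ?N u / n u) + (\<Sum>e\<in>edges (H \<tau>). ?E e / k e) \<le> energy (H \<tau>) (\<theta>T \<tau>) y"
        if y: "y \<in> PiE (nodes (H \<tau>)) Y" for y
      proof -
        have N: "?N u / n u \<le> node_cost S u (y u)" if u: "u \<in> nodes (H \<tau>)" for u
        proof -
          have "u \<in> nodes G" using u sub by auto
          moreover have "y u \<in> Y u" using u y by auto
          ultimately show ?thesis using labels n[of u] by (auto simp: S_def intro!: divide_right_mono)
        qed
        have E: "?E e / k e \<le> edge_cost S e (y (fst e), y (snd e))" if e: "e \<in> edges (H \<tau>)" for e
        proof -
          have "fst e \<in> nodes (H \<tau>)" "snd e \<in> nodes (H \<tau>)" "e \<in> edges G" using e sub by auto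
          moreover from this have "y (fst e) \<in> Y (fst e)" "y (snd e) \<in> Y (snd e)"
            "finite (Y (fst e))" "finite (Y (snd e))" using y sub labels by auto
          ultimately show ?thesis using k[of e] by (auto simp: S_def intro!: divide_right_mono Min_le)
        qed
        have "(\<Sum>u\<in>nodes (H \<tau>). ?N u / n u) + (\<Sum>e\<in>edges (H \<tau>). ?E e / k e) \<le> energy (H \<tau>) S y"
          unfolding energy_def case_prod_unfold using N E
          by (intro add_mono sum_mono) simp_all
        \<comment> \<open>On the slave, \<open>\<theta>T \<tau>\<close> is a reparametrization of
          \<open>S\<close>, so both have the same energy.\<close>
        then show ?thesis by (simp add: \<theta>T_def energy_reparametrize[OF slave_graph[OF \<tau>]])
      qed
      then show "(\<Sum>u\<in>nodes (H \<tau>). ?N u / n u) + (\<Sum>e\<in>edges (H \<tau>). ?E e / k e)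
          \<le> (MIN y\<in>PiE (nodes (H \<tau>)) Y. energy (H \<tau>) (\<theta>T \<tau>) y)"
        using finite_PiE_slave[OF \<tau>] PiE_slave_ne[OF \<tau>] by simp
    qed
    finally show ?thesis .
  qed
  ultimately show ?thesis by blast
qed

end

theorem proposition9p3:
  fixes G :: "'v graph" and Y :: "'v \<Rightarrow> 'l set" and \<theta> :: "('v, 'l) costs"
    and T :: "'t set" and H :: "'t \<Rightarrow> 'v graph"
  assumes "graphical_model G Y"
    and "decomposition G T H"
    and "\<forall>\<tau> \<in> T. acyclic_graph (H \<tau>)"
  shows "\<exists>\<theta>T \<phi>.
      is_arg_max (decomposition_dual Y T H) (\<lambda>\<theta>T. \<theta>T \<in> slave_costs G Y \<theta> T H) \<theta>T \<and>
      is_arg_max (lagrange_dual G Y \<theta>) (\<lambda>_. True) \<phi> \<and>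
      decomposition_dual Y T H \<theta>T = lagrange_dual G Y \<theta> \<phi>"
proof -
  obtain \<phi> where \<phi>: "\<And>\<phi>'. lagrange_dual G Y \<theta> \<phi>' \<le> lagrange_dual G Y \<theta> \<phi>"
    using lagrange_dual_attains_max[OF assms(1)] by blast
  \<comment> \<open>Slave costs built from an optimal \<open>\<phi>\<close> reach the maximum of the
    Lagrange dual, which no slave costs can exceed; hence they are optimal.\<close>
  obtain \<theta>T where \<theta>T: "\<theta>T \<in> slave_costs G Y \<theta> T H"
    and ge: "lagrange_dual G Y \<theta> \<phi> \<le> decomposition_dual Y T H \<theta>T"
    using lagrange_dual_le_decomposition_dual[OF assms(1,2)] by blast
  have le: "decomposition_dual Y T H \<theta>T' \<le> lagrange_dual G Y \<theta> \<phi>"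
    if "\<theta>T' \<in> slave_costs G Y \<theta> T H" for \<theta>T'
    using decomposition_dual_le_lagrange_dual[OF assms that] \<phi> order_trans by blast
  have "decomposition_dual Y T H \<theta>T = lagrange_dual G Y \<theta> \<phi>"
    using le[OF \<theta>T] ge by (rule antisym)
  then show ?thesis using \<theta>T le \<phi> by (intro exI[of _ \<theta>T] exI[of _ \<phi>]) (simp add: is_arg_max_linorder)
qed

end
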